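(* Let $c_1=\big(\frac{e^2}{2\sqrt\pi}\big)^{1/2}$. There exist absolute constants $c_2,c_3,c_4>0$ such that: (i) for all $n,k\in\mathbb{N}$ with $n\ge k+2$, $$\tau_{n,k}\le c_1\Big(\frac{2}{e}\Big)^k\frac{k^{1/4}}{(1-\frac{k^2}{n^2})^{k/2}},$$ and in particular $\tau_{n,k}<c_2\big(\frac2e\big)^k k^{1/4}$ whenever $n\ge k+2$ and $n\ge k^{3/2}$; (ii) for all $m\ge 2$ and $n\ge m+1$ (so that $k=n-m\ge1$), $$\tau_{n,n-m}\le c_3\,m^{1/4}\Big(\frac{me}{2}\Big)^{m/2}n^{-m/2};$$ (iii) for every $\lambda\in(0,1)$ there is $\rho_\lambda<1$ such that, with $k=\lfloor\lambda n\rfloor$ (whenever $k\ge1$ and $n\ge k+2$), $\tau_{n,k}\le c_4\,n^{1/4}\rho_\lambda^{n/2}$; in particular, for even $n\ge 4$, $$\tau_{n,n/2}<c_1\,n^{1/4}\Big(\frac{4}{\sqrt{27}}\Big)^{n/2}.$$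
   Context: $T_n$ denotes the Chebyshev polynomial of the first kind of degree $n$, $T_n(\cos\theta)=\cos n\theta$. For integers $n\ge k+2$, $k\ge 1$, let $\omega_{n,k}$ be the rightmost (largest) zero of $T_n^{(k+1)}$ and define $\tau_{n,k}:=|T_n^{(k)}(\omega_{n,k})|/T_n^{(k)}(1)$. *)

theory Defs
  imports Complex_Main "HOL-Computational_Algebra.Polynomial"
begin

text \<open>Chebyshev polynomials of the first kind, as real polynomials:
  T_0 = 1, T_1 = x, T_(n+2) = 2 x T_(n+1) - T_n  (so that T_n(cos t) = cos(n t)).\<close>
fun cheb :: "nat \<Rightarrow> real poly" where
  "cheb 0 = 1"
| "cheb (Suc 0) = [:0, 1:]"
| "cheb (Suc (Suc n)) = [:0, 2:] * cheb (Suc n) - cheb n"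

definition cheb_deriv :: "nat \<Rightarrow> nat \<Rightarrow> real poly" where
  "cheb_deriv n k = (pderiv ^^ k) (cheb n)"

definition omega :: "nat \<Rightarrow> nat \<Rightarrow> real" where
  "omega n k = Max {x. poly (cheb_deriv n (k + 1)) x = 0}"

definition tau :: "nat \<Rightarrow> nat \<Rightarrow> real" where
  "tau n k = \<bar>poly (cheb_deriv n k) (omega n k)\<bar> / poly (cheb_deriv n k) 1"

definition c1 :: real where
  "c1 = sqrt (exp 2 / (2 * sqrt pi))"

end

theory Submission
  imports Defs "HOL-Analysis.Harmonic_Numbers"
begin

text \<open>
  Write \<open>\<omega>\<close> for the rightmost zero of \<open>T_n^(k+1)\<close>. Adding to \<open>(T_n^(k))\<^sup>2\<close> the square of the
  conjugate function \<open>S_n^(k)\<close>, \<open>S_n(cos t) = sin (n t)\<close>, gives the Duffin--Schaeffer majorant, which is an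
  explicit polynomial with nonnegative coefficients in \<open>s = 1 / (1 - x\<^sup>2)\<close>. The differential equation of
  \<open>T_n^(k)\<close> yields \<open>1 - \<omega>\<^sup>2 \<ge> (k+1)\<^sup>2 / n\<^sup>2\<close>; for such \<open>s\<close> the \<open>m\<close>-th coefficient of the majorant
  contributes at most \<open>(2m choose m) / 4^m\<close>, and these weights add up to order \<open>sqrt k\<close>. Dividing by
  \<open>T_n^(k)(1)\<^sup>2\<close> and applying Stirling-type bounds to the factorials, \<open>tau\<^sup>2\<close> is at most a constant
  times \<open>sqrt (k * (n\<^sup>2 - k\<^sup>2)) / n * 4^k * n^(2*k) * (n-k)^(n-k) / (n+k)^(n+k)\<close>. Every assertion is a
  specialisation of this single bound.
\<close>

section \<open>Derivatives of Chebyshev polynomials\<close>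

text \<open>At \<open>x = cos t\<close> this is \<open>n\<close> times
  \<open>sin t * sin (n t) = cos t * cos (n t) - cos ((n + 1) t)\<close>. It removes derivatives
  from the proofs of the differential equation and of \<open>cheb_pell\<close>.\<close>

lemma one_minus_sq_pderiv_cheb:
  "(1 - x^2) * poly (pderiv (cheb n)) x
    = real n * (x * poly (cheb n) x - poly (cheb (Suc n)) x)"
proof (induction n rule: cheb.induct)
  case (3 n)
  have *: "poly (pderiv (cheb (Suc (Suc n)))) x
      = 2 * poly (cheb (Suc n)) x + 2 * x * poly (pderiv (cheb (Suc n))) x - poly (pderiv (cheb n)) x"
    by (simp add: pderiv_mult pderiv_diff pderiv_pCons pderiv_smult)
  have "(1 - x^2) * poly (pderiv (cheb (Suc (Suc n)))) x
      = 2 * (1 - x^2) * poly (cheb (Suc n)) x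
        + 2 * x * ((1 - x^2) * poly (pderiv (cheb (Suc n))) x)
        - (1 - x^2) * poly (pderiv (cheb n)) x"
    unfolding * by (simp add: algebra_simps)
  then show ?case
    unfolding 3 by (simp add: algebra_simps power2_eq_square)
qed (auto simp: pderiv_pCons algebra_simps power2_eq_square)

lemma cheb_ode:
  "(1 - x^2) * poly (pderiv (pderiv (cheb n))) x
    = x * poly (pderiv (cheb n)) x - real n ^ 2 * poly (cheb n) x"
proof (induction n rule: cheb.induct)
  case (3 n)
  let ?T = "\<lambda>j. poly (cheb j) x" and ?D = "\<lambda>j. poly (pderiv (cheb j)) x"
    and ?DD = "\<lambda>j. poly (pderiv (pderiv (cheb j))) x"
  have 1: "?D (Suc (Suc n)) = 2 * ?T (Suc n) + 2 * x * ?D (Suc n) - ?D n"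
    by (simp add: pderiv_mult pderiv_diff pderiv_pCons pderiv_smult)
  have 2: "?DD (Suc (Suc n)) = 4 * ?D (Suc n) + 2 * x * ?DD (Suc n) - ?DD n"
    by (simp add: pderiv_mult pderiv_diff pderiv_pCons pderiv_add pderiv_smult)
  have "(1 - x^2) * ?DD (Suc (Suc n))
      = 4 * ((1 - x^2) * ?D (Suc n)) + 2 * x * ((1 - x^2) * ?DD (Suc n)) - (1 - x^2) * ?DD n"
    unfolding 2 by (simp add: algebra_simps)
  also have "\<dots> = x * ?D (Suc (Suc n)) - real (Suc (Suc n)) ^ 2 * ?T (Suc (Suc n))"
    unfolding 3 one_minus_sq_pderiv_cheb 1 by (simp add: algebra_simps power2_eq_square)
  finally show ?case .
qed (auto simp: pderiv_pCons)

lemma cheb_deriv_Suc: "cheb_deriv n (Suc k) = pderiv (cheb_deriv n k)"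
  by (simp add: cheb_deriv_def)

text \<open>Each induction step differentiates the previous equation, hence the form as an identity
  of polynomials rather than of values.\<close>

lemma cheb_deriv_ode_poly:
  "[:1, 0, -1:] * cheb_deriv n (Suc (Suc k))
    = smult (2 * real k + 1) ([:0, 1:] * cheb_deriv n (Suc k))
      - smult (real n ^ 2 - real k ^ 2) (cheb_deriv n k)"
proof (induction k)
  case 0
  show ?case
    by (rule poly_ext)
      (use cheb_ode[of _ n] in \<open>simp add: cheb_deriv_def algebra_simps power2_eq_square\<close>)
next
  case (Suc k)
  let ?P = "cheb_deriv n"
  have "pderiv ([:1, 0, -1:] * ?P (Suc (Suc k)))
     = pderiv (smult (2 * real k + 1) ([:0, 1:] * ?P (Suc k))
        - smult (real n ^ 2 - real k ^ 2) (?P k))"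
    by (simp only: Suc)
  then have "[:1, 0, -1:] * ?P (Suc (Suc (Suc k))) + ?P (Suc (Suc k)) * [:0, -2:]
     = smult (2 * real k + 1) ([:0, 1:] * ?P (Suc (Suc k)) + ?P (Suc k))
        - smult (real n ^ 2 - real k ^ 2) (?P (Suc k))"
    by (simp only: cheb_deriv_Suc pderiv_mult pderiv_diff pderiv_smult) (simp add: pderiv_pCons)
  then have *: "poly ([:1, 0, -1:] * ?P (Suc (Suc (Suc k))) + ?P (Suc (Suc k)) * [:0, -2:]) x
     = poly (smult (2 * real k + 1) ([:0, 1:] * ?P (Suc (Suc k)) + ?P (Suc k))
        - smult (real n ^ 2 - real k ^ 2) (?P (Suc k))) x" for x
    by simp
  show ?case
    by (rule poly_ext) (use * in \<open>simp add: algebra_simps power2_eq_square\<close>)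
qed

lemma cheb_deriv_ode:
  "(1 - x^2) * poly (cheb_deriv n (Suc (Suc k))) x
    = (2 * real k + 1) * x * poly (cheb_deriv n (Suc k)) x
      - (real n ^ 2 - real k ^ 2) * poly (cheb_deriv n k) x"
  using arg_cong[OF cheb_deriv_ode_poly[of n k], of "\<lambda>p. poly p x"]
  by (simp add: algebra_simps power2_eq_square)

text \<open>The recurrence preserves this quadratic form in consecutive terms; its value is read off
  at \<open>n = 0\<close>.\<close>

lemma cheb_consecutive:
  "poly (cheb n) x ^ 2 + poly (cheb (Suc n)) x ^ 2
     - 2 * x * poly (cheb n) x * poly (cheb (Suc n)) x = 1 - x^2"
  by (induction n) (simp_all add: algebra_simps power2_eq_square)

text \<open>The identity \<open>cos^2 + sin^2 = 1\<close> at the angle \<open>n t\<close>. It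
  supplies the initial values of the majorant.\<close>

lemma cheb_pell:
  assumes "x^2 \<noteq> 1"
  shows "real n ^ 2 * poly (cheb n) x ^ 2 + (1 - x^2) * poly (pderiv (cheb n)) x ^ 2 = real n ^ 2"
proof -
  let ?T = "poly (cheb n) x" and ?U = "poly (cheb (Suc n)) x" and ?D = "poly (pderiv (cheb n)) x"
  have "((1 - x^2) * ?D)^2 = real n ^ 2 * ((x * ?T - ?U)^2)"
    unfolding one_minus_sq_pderiv_cheb by (simp add: power_mult_distrib)
  also have "(x * ?T - ?U)^2 = (1 - x^2) * (1 - ?T^2)"
    using cheb_consecutive[of n x] by (simp add: algebra_simps power2_eq_square)
  finally have "(1 - x^2) * ((1 - x^2) * ?D^2) = (1 - x^2) * (real n ^ 2 * (1 - ?T^2))"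
    by (simp add: algebra_simps power2_eq_square)
  then have "(1 - x^2) * ?D^2 = real n ^ 2 * (1 - ?T^2)"
    using assms by (metis eq_iff_diff_eq_0 mult_left_cancel)
  then show ?thesis by (simp add: algebra_simps)
qed

section \<open>Endpoint values, degree and parity\<close>

lemma cheb_1: "poly (cheb n) 1 = 1"
  by (induction n rule: cheb.induct) auto

lemma degree_cheb_le: "degree (cheb n) \<le> n"
proof (induction n rule: cheb.induct)
  case (3 n)
  have "degree ([:0, 2:] * cheb (Suc n)) \<le> Suc (Suc n)"
    using degree_mult_le[of "[:0, 2::real:]" "cheb (Suc n)"] 3(1) by simp
  with 3(2) show ?case
    by (auto intro!: degree_diff_le)
qed auto

lemma degree_cheb_deriv_le: "degree (cheb_deriv n k) \<le> n - k"
proof (induction k)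
  case 0
  then show ?case by (simp add: cheb_deriv_def degree_cheb_le)
next
  case (Suc k)
  then show ?case by (simp add: cheb_deriv_Suc degree_pderiv)
qed

lemma cheb_deriv_Suc_self: "cheb_deriv n (Suc n) = 0"
  using degree_cheb_deriv_le[of n n] by (simp add: cheb_deriv_Suc pderiv_eq_0_iff)

lemma cheb_parity: "pcompose (cheb n) [:0, -1:] = smult ((-1) ^ n) (cheb n)"
  by (induction n rule: cheb.induct)
    (simp_all add: pcompose_pCons pcompose_diff pcompose_mult pcompose_smult smult_diff_right one_pCons mult.commute)

lemma cheb_deriv_parity:
  "pcompose (cheb_deriv n k) [:0, -1:] = smult ((-1) ^ (n + k)) (cheb_deriv n k)"
proof (induction k)
  case 0
  then show ?case by (simp add: cheb_deriv_def cheb_parity)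
next
  case (Suc k)
  have "pcompose (cheb_deriv n (Suc k)) [:0, -1:] * [:-1:]
      = pderiv (pcompose (cheb_deriv n k) [:0, -1:])"
    by (simp add: pderiv_pcompose cheb_deriv_Suc pderiv_pCons)
  also have "\<dots> = smult ((-1) ^ (n + k)) (cheb_deriv n (Suc k))"
    by (simp add: Suc pderiv_smult cheb_deriv_Suc)
  finally have "pcompose (cheb_deriv n (Suc k)) [:0, -1:] * [:-1:]
      = smult ((-1) ^ (n + k)) (cheb_deriv n (Suc k))" .
  then show ?case
    by (simp add: minus_equation_iff[of _ "smult _ _"])
qed

text \<open>Symmetry of the zeros makes the largest one nonnegative.\<close>

lemma cheb_deriv_uminus_root:
  assumes "poly (cheb_deriv n k) x = 0"
  shows "poly (cheb_deriv n k) (- x) = 0"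
  using arg_cong[OF cheb_deriv_parity[of n k], of "\<lambda>p. poly p x"] assms
  by (simp add: poly_pcompose)

text \<open>The second-order term drops out at \<open>x = 1\<close>, leaving a first-order
  recurrence for the endpoint values.\<close>

lemma cheb_deriv_1_Suc:
  "(2 * real k + 1) * poly (cheb_deriv n (Suc k)) 1
    = (real n ^ 2 - real k ^ 2) * poly (cheb_deriv n k) 1"
  using cheb_deriv_ode[of 1 n k] by simp

lemma cheb_deriv_1_pos: "k \<le> n \<Longrightarrow> poly (cheb_deriv n k) 1 > 0"
proof (induction k)
  case 0
  then show ?case by (simp add: cheb_deriv_def cheb_1)
next
  case (Suc k)
  then have "real n ^ 2 - real k ^ 2 > 0"
    by (simp add: power_strict_mono)
  with Suc have "(2 * real k + 1) * poly (cheb_deriv n (Suc k)) 1 > 0"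
    by (simp add: cheb_deriv_1_Suc)
  then show ?case
    by (simp add: zero_less_mult_iff)
qed

text \<open>Rolle's theorem for \<open>(1 - x\<^sup>2) powr (k + 1/2) * T_n^(k+1)\<close>, whose derivative is
  a multiple of \<open>T_n^(k)\<close> by the differential equation.\<close>
lemma cheb_deriv_has_root:
  assumes "k < n"
  obtains x where "-1 < x" "x < 1" "poly (cheb_deriv n k) x = 0"
proof -
  let ?P = "\<lambda>k. poly (cheb_deriv n k)"
  define g where "g x = (1 - x^2) ^ k * sqrt (1 - x^2) * ?P (Suc k) x" for x
  have der: "(g has_real_derivative
      (- ((1 - x^2) ^ k) / sqrt (1 - x^2) * (real n ^ 2 - real k ^ 2) * ?P k x)) (at x)"
    if x: "-1 < x" "x < 1" for x
  proof -
    have x2: "0 < 1 - x^2"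
      using x by (simp add: abs_square_less_1 abs_less_iff)
    have D: "(?P (Suc k) has_real_derivative ?P (Suc (Suc k)) x) (at x)"
      by (simp add: cheb_deriv_Suc poly_DERIV)
    have R: "a * sqrt (1 - x^2) = a / sqrt (1 - x^2) * (1 - x^2)" for a
      using x2 by (simp add: field_simps)
    have S: "((\<lambda>x. sqrt (1 - x^2)) has_real_derivative - x / sqrt (1 - x^2)) (at x)"
      using x2 by (auto intro!: derivative_eq_intros simp: field_simps)
    have "(g has_real_derivative
      (real k * (1 - x^2) ^ (k - 1) * (- 2 * x)) * sqrt (1 - x^2) * ?P (Suc k) x
       + (1 - x^2) ^ k * (- x / sqrt (1 - x^2)) * ?P (Suc k) x
       + (1 - x^2) ^ k * sqrt (1 - x^2) * ?P (Suc (Suc k)) x) (at x)"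
      unfolding g_def
      by (rule derivative_eq_intros S D refl)+ (simp add: algebra_simps)
    \<comment> \<open>At \<open>k = 0\<close> the truncated exponent \<open>k - 1\<close> is
      harmless, because the factor \<open>real k\<close> is zero.\<close>
    also have "(real k * (1 - x^2) ^ (k - 1) * (- 2 * x)) * sqrt (1 - x^2)
        = - ((1 - x^2) ^ k) / sqrt (1 - x^2) * (2 * real k * x)"
      using R[of "real k * (1 - x^2) ^ (k - 1) * (- 2 * x)"] by (cases k) (simp_all add: mult_ac)
    also have "(1 - x^2) ^ k * sqrt (1 - x^2) * ?P (Suc (Suc k)) x
        = (1 - x^2) ^ k / sqrt (1 - x^2) * ((1 - x^2) * ?P (Suc (Suc k)) x)"
      by (simp add: R)
    also have "- ((1 - x^2) ^ k) / sqrt (1 - x^2) * (2 * real k * x) * ?P (Suc k) x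
        + (1 - x^2) ^ k * (- x / sqrt (1 - x^2)) * ?P (Suc k) x
        + (1 - x^2) ^ k / sqrt (1 - x^2) * ((1 - x^2) * ?P (Suc (Suc k)) x)
        = - ((1 - x^2) ^ k / sqrt (1 - x^2) * ((2 * real k + 1) * x * ?P (Suc k) x
        - (1 - x^2) * ?P (Suc (Suc k)) x))"
      by (simp add: ring_distribs)
    also have "\<dots> = - ((1 - x^2) ^ k) / sqrt (1 - x^2) * (real n ^ 2 - real k ^ 2) * ?P k x"
      unfolding cheb_deriv_ode by simp
    finally show ?thesis .
  qed
  have cont: "continuous_on {-1..1} g"
    unfolding g_def by (intro continuous_intros)
  \<comment> \<open>The factor \<open>sqrt (1 - x^2)\<close> makes \<open>g\<close> vanish at both
    endpoints.\<close>
  have "\<exists>z>-1. z < 1 \<and> (g has_real_derivative 0) (at z)"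
    by (rule Rolle[OF _ _ cont]) (use der in \<open>auto simp: g_def real_differentiable_def\<close>)
  then obtain z where z: "-1 < z" "z < 1" "(g has_real_derivative 0) (at z)"
    by blast
  have z2: "0 < 1 - z^2"
    using z by (simp add: abs_square_less_1 abs_less_iff)
  have n: "real n ^ 2 - real k ^ 2 > 0"
    using assms by (simp add: power_strict_mono)
  have "- ((1 - z^2) ^ k) / sqrt (1 - z^2) * (real n ^ 2 - real k ^ 2) * ?P k z = 0"
    using DERIV_unique[OF der z(3)] z by blast
  with z2 n have "?P k z = 0" by auto
  with z show ?thesis using that by blast
qed

text \<open>Descending induction on the order of the derivative, starting from the constant \<open>T_n^(n)\<close>. The
  hypothesis makes \<open>(j + 1/2) * x / (n\<^sup>2 - j\<^sup>2)\<close> a lower bound for the ratio of consecutive derivatives.\<close>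
lemma cheb_deriv_pos:
  assumes "k < n" "0 < x" "(1 - x^2) * (real n ^ 2 - 1/4) \<le> (real k + 1)^2 - 1/4"
  shows "poly (cheb_deriv n k) x > 0"
proof -
  let ?P = "\<lambda>j. poly (cheb_deriv n j) x"
  have "(real n ^ 2 - real j ^ 2) * ?P j \<ge> (real j + 1/2) * x * ?P (Suc j) \<and> ?P j > 0 \<and> ?P (Suc j) \<ge> 0"
    if "k \<le> j" "j \<le> n" for j
    using that(2,1)
  proof (induction j rule: inc_induct)
    case base
    have "degree (cheb_deriv n n) = 0"
      using degree_cheb_deriv_le[of n n] by simp
    then have "?P n = poly (cheb_deriv n n) 1"
      by (auto elim!: degree_eq_zeroE)
    then show ?case
      using cheb_deriv_1_pos[of n n] by (simp add: cheb_deriv_Suc_self)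
  next
    case (step j)
    then have IH: "(real n ^ 2 - (real j + 1) ^ 2) * ?P (Suc j) \<ge> (real j + 3/2) * x * ?P (Suc (Suc j))"
      and pos: "?P (Suc j) > 0" "?P (Suc (Suc j)) \<ge> 0"
      by (simp_all add: algebra_simps)
    have nj: "real n ^ 2 - real j ^ 2 > 0"
      using step by (simp add: power_strict_mono)
    \<comment> \<open>Since \<open>(j + 1/2) * (j + 3/2) = (j + 1)^2 - 1/4\<close>, this is the
      hypothesis rearranged, with \<open>k\<close> raised to \<open>j\<close>.\<close>
    have "(1 - x^2) * (real n ^ 2 - (real j + 1)^2) \<le> (real j + 3/2) * (real j + 1/2) * x^2"
    proof -
      have "(real k + 1)^2 \<le> (real j + 1)^2"
        using step by (simp add: power_mono)
      with assms(3) have "(1 - x^2) * (real n ^ 2 - 1/4) \<le> (real j + 1)^2 - 1/4"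
        by linarith
      moreover have "(real j + 3/2) * (real j + 1/2) * x^2 - (1 - x^2) * (real n ^ 2 - (real j + 1)^2)
          = ((real j + 1)^2 - 1/4) - (1 - x^2) * (real n ^ 2 - 1/4)"
        by (simp add: field_simps power2_eq_square)
      ultimately show ?thesis by linarith
    qed
    \<comment> \<open>In the differential equation this uses up only half of the term
      \<open>(2 * j + 1) * x * ?P (Suc j)\<close>; the other half is the claimed lower
      bound.\<close>
    have "(1 - x^2) * ?P (Suc (Suc j)) \<le> (real j + 1/2) * x * ?P (Suc j)"
    proof (cases "1 - x^2 > 0")
      case True
      have "(real j + 3/2) * x * ((1 - x^2) * ?P (Suc (Suc j)))
          \<le> (1 - x^2) * ((real n ^ 2 - (real j + 1) ^ 2) * ?P (Suc j))"
        using mult_left_mono[OF IH, of "1 - x^2"] True by (simp add: mult_ac)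
      also have "\<dots> \<le> ((real j + 3/2) * (real j + 1/2) * x^2) * ?P (Suc j)"
        using mult_right_mono[OF \<open>(1 - x^2) * (real n ^ 2 - (real j + 1)^2) \<le> _\<close>, of "?P (Suc j)"] pos
        by (simp add: mult_ac)
      also have "\<dots> = (real j + 3/2) * x * ((real j + 1/2) * x * ?P (Suc j))"
        by (simp add: power2_eq_square)
      finally show ?thesis
        using assms(2) by (simp add: mult_le_cancel_left_pos)
    next
      case False
      then have "(1 - x^2) * ?P (Suc (Suc j)) \<le> 0"
        using pos by (simp add: mult_nonpos_nonneg)
      also have "\<dots> \<le> (real j + 1/2) * x * ?P (Suc j)"
        using pos assms(2) by simp
      finally show ?thesis .
    qed
    with cheb_deriv_ode[of x n j]
    have "(real n ^ 2 - real j ^ 2) * ?P j \<ge> (real j + 1/2) * x * ?P (Suc j)"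
      by (simp add: algebra_simps)
    moreover have "(real j + 1/2) * x * ?P (Suc j) > 0"
      using pos assms(2) by simp
    ultimately show ?case
      using nj pos by (smt (verit) zero_less_mult_iff)
  qed
  from this[of k] assms(1) show ?thesis by simp
qed

section \<open>The Duffin--Schaeffer majorant\<close>

text \<open>Equals \<open>(2m choose m) / 4^m\<close>; the product form gives the ratio of
  consecutive weights at once.\<close>

definition central_weight :: "nat \<Rightarrow> real" where
  "central_weight m = (\<Prod>j<m. (2 * real j + 1) / (2 * real j + 2))"

lemma central_weight_pos: "central_weight m > 0"
  unfolding central_weight_def by (intro prod_pos) auto

lemma central_weight_Suc:
  "central_weight (Suc m) = central_weight m * ((2 * real m + 1) / (2 * real m + 2))"
  by (simp add: central_weight_def)

text \<open>Telescoping: \<open>2 * (k + 1)\<close> times the next weight is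
  \<open>2 * k + 1\<close> times the current one.\<close>

lemma sum_central_weight: "(\<Sum>m<k. central_weight m) = 2 * real k * central_weight k"
proof (induction k)
  case (Suc k)
  have "2 * real (Suc k) * central_weight (Suc k) = (2 * real k + 1) * central_weight k"
    by (simp add: central_weight_Suc divide_simps)
  with Suc show ?case by (simp add: algebra_simps)
qed simp

text \<open>Wallis-type monotonicity: the left side starts at 1 and its successive ratios are
  \<open>(2k+1)(2k+3) / (2k+2)^2\<close>, at most 1.\<close>

lemma central_weight_sq_le: "(2 * real k + 1) * central_weight k ^ 2 \<le> 1"
proof (induction k)
  case 0
  then show ?case by (simp add: central_weight_def)
next
  case (Suc k)
  have "(2 * real (Suc k) + 1) * central_weight (Suc k) ^ 2
      = ((2 * real k + 1) * central_weight k ^ 2)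
        * ((2 * real k + 1) * (2 * real k + 3) / (2 * real k + 2) ^ 2)"
    by (simp add: central_weight_Suc power2_eq_square field_simps)
  also have "\<dots> \<le> 1 * 1"
  proof (rule mult_mono)
    have "(2 * real k + 1) * (2 * real k + 3) \<le> (2 * real k + 2) ^ 2"
      by (simp add: power2_eq_square algebra_simps)
    then show "(2 * real k + 1) * (2 * real k + 3) / (2 * real k + 2) ^ 2 \<le> 1"
      by (simp add: divide_le_eq_1)
  qed (use Suc in auto)
  finally show ?case by simp
qed

text \<open>Up to the factor \<open>ds_lead n k\<close>, the coefficients of the Duffin--Schaeffer majorant. In
  binomial form: \<open>((k - 1 + m) choose (2 * m)) * ((2 * m - 1)!!)\<^sup>2\<close> divided by
  \<open>(n\<^sup>2 - 1\<^sup>2) \<cdots> (n\<^sup>2 - m\<^sup>2)\<close>. For \<open>m \<ge> n\<close> the denominator vanishes, so only \<open>m < n\<close> is meaningful.\<close>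
definition ds_coeff :: "nat \<Rightarrow> nat \<Rightarrow> nat \<Rightarrow> real" where
  "ds_coeff n k m = central_weight m *
     (\<Prod>j<m. (real k - 1 - real j) * (real k + real j) / (real n ^ 2 - (real j + 1) ^ 2))"

text \<open>This is \<open>(2k-1)!!\<close> times \<open>T_n^(k)(1)\<close>; taking it out
  normalises the majorant to constant coefficient 1.\<close>

definition ds_lead :: "nat \<Rightarrow> nat \<Rightarrow> real" where
  "ds_lead n k = (\<Prod>j<k. real n ^ 2 - real j ^ 2)"

lemma ds_coeff_0 [simp]: "ds_coeff n k 0 = 1"
  by (simp add: ds_coeff_def central_weight_def)

lemma ds_coeff_Suc:
  "ds_coeff n k (Suc m) = ds_coeff n k m * ((2 * real m + 1) / (2 * real m + 2)
     * ((real k - 1 - real m) * (real k + real m) / (real n ^ 2 - (real m + 1) ^ 2)))"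
  by (simp add: ds_coeff_def central_weight_Suc)

text \<open>The factor with \<open>j = k - 1\<close> vanishes; for \<open>k = 0\<close> it is
  \<open>real k + real j\<close> at \<open>j = 0\<close> that does.\<close>

lemma ds_coeff_eq_0:
  assumes "k \<le> m" "0 < m"
  shows "ds_coeff n k m = 0"
proof -
  have "\<exists>j\<in>{..<m}. (real k - 1 - real j) * (real k + real j) = 0"
  proof (cases k)
    case 0
    then show ?thesis using assms by (intro bexI[of _ 0]) auto
  next
    case (Suc k')
    then show ?thesis using assms by (intro bexI[of _ k']) auto
  qed
  then show ?thesis by (auto simp: ds_coeff_def)
qed

text \<open>In binomial form, the absorption rule relating \<open>(k - 1 + m) choose (2 * m)\<close>
  to \<open>(k + m) choose (2 * m)\<close>.\<close>

lemma ds_coeff_shift: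
  "(real k + real m) * ds_coeff n k m = (real k - real m) * ds_coeff n (Suc k) m"
proof (induction m)
  case (Suc m)
  define c where "c = (2 * real m + 1) / (2 * real m + 2) / (real n ^ 2 - (real m + 1) ^ 2)"
  have 1: "ds_coeff n k (Suc m) = ds_coeff n k m * c * (real k - 1 - real m) * (real k + real m)"
    by (simp add: ds_coeff_Suc c_def)
  have 2: "ds_coeff n (Suc k) (Suc m)
      = ds_coeff n (Suc k) m * c * (real k - real m) * (real k + 1 + real m)"
    by (simp add: ds_coeff_Suc c_def)
  have "(real k + real (Suc m)) * ds_coeff n k (Suc m)
      = (real k + 1 + real m) * c * (real k - 1 - real m) * ((real k + real m) * ds_coeff n k m)"
    unfolding 1 by (simp add: algebra_simps)
  also have "\<dots> = (real k - real (Suc m)) * ds_coeff n (Suc k) (Suc m)"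
    unfolding 2 Suc by (simp add: algebra_simps)
  finally show ?case .
qed simp

text \<open>The coefficient of \<open>s^(m+1)\<close> in the recurrence
  \<open>ds_sum_Suc_Suc\<close>.\<close>

lemma ds_coeff_three_term:
  assumes "Suc m < n"
  shows "(real n ^ 2 - (real k + 1) ^ 2) * ds_coeff n (Suc (Suc k)) (Suc m)
    = (2 * real k + 1) * ((2 * real m + 1) * ds_coeff n (Suc k) m
        - (2 * real m + 3) * ds_coeff n (Suc k) (Suc m))
      + (real n ^ 2 - real k ^ 2) * ds_coeff n k (Suc m)"
proof -
  have n: "real n ^ 2 - (real m + 1) ^ 2 \<noteq> 0"
    using assms power_strict_mono[of "real m + 1" "real n" 2] by simp
  \<comment> \<open>In terms of \<open>z\<close> all four coefficients carry polynomial factors, so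
    a polynomial identity remains.\<close>
  define z where "z = ds_coeff n (Suc k) m * ((2 * real m + 1) / (2 * real m + 2))
      / (real n ^ 2 - (real m + 1) ^ 2)"
  have m: "(2 * real m + 1) * ds_coeff n (Suc k) m
      = (2 * real m + 2) * (real n ^ 2 - (real m + 1) ^ 2) * z"
    using n by (simp add: z_def divide_simps)
  have 1: "ds_coeff n (Suc k) (Suc m) = z * (real k - real m) * (real k + 1 + real m)"
    by (simp add: ds_coeff_Suc z_def)
  have "ds_coeff n (Suc (Suc k)) (Suc m)
      = (real (Suc k) - real m) * ds_coeff n (Suc (Suc k)) m
         * ((2 * real m + 1) / (2 * real m + 2)) / (real n ^ 2 - (real m + 1) ^ 2)
         * (real k + 2 + real m)"
    by (simp add: ds_coeff_Suc)
  also have "\<dots> = z * (real k + 1 + real m) * (real k + 2 + real m)"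
    unfolding ds_coeff_shift[of "Suc k" m n, symmetric] by (simp add: z_def)
  finally have 2: "ds_coeff n (Suc (Suc k)) (Suc m) = z * (real k + 1 + real m) * (real k + 2 + real m)" .
  have "(real k + 1 + real m) * ds_coeff n k (Suc m)
     = (real k + 1 + real m) * (z * (real k - real m) * (real k - 1 - real m))"
    using ds_coeff_shift[of k "Suc m" n] unfolding 1 by (simp add: algebra_simps)
  moreover have "real k + 1 + real m \<noteq> 0" by linarith
  ultimately have 3: "ds_coeff n k (Suc m) = z * (real k - real m) * (real k - 1 - real m)"
    by (metis mult_left_cancel)
  show ?thesis
    unfolding m 1 2 3 by (simp add: algebra_simps power2_eq_square)
qed

section \<open>Recurrences for the majorant sums\<close>

lemma ds_lead_Suc: "ds_lead n (Suc k) = (real n ^ 2 - real k ^ 2) * ds_lead n k"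
  by (simp add: ds_lead_def)

lemma ds_lead_pos: "k \<le> n \<Longrightarrow> ds_lead n k > 0"
  unfolding ds_lead_def by (intro prod_pos) (auto simp: power_strict_mono)

text \<open>A range independent of \<open>k\<close> lets sums for different \<open>k\<close> be
  combined termwise; terms with \<open>0 < m\<close> and \<open>k \<le> m\<close> vanish.\<close>

definition ds_sum :: "nat \<Rightarrow> nat \<Rightarrow> real \<Rightarrow> real" where
  "ds_sum n k s = (\<Sum>m<n. ds_coeff n k m * s ^ m)"

text \<open>The weight comes from differentiating \<open>s^(k+m)\<close>: as
  \<open>ds/dx = 2 * x * s^2\<close>, half the derivative of \<open>s^k * ds_sum n k s\<close> in
  \<open>x\<close> is \<open>x * s^(k+1) * ds_wsum n k s\<close>.\<close>

definition ds_wsum :: "nat \<Rightarrow> nat \<Rightarrow> real \<Rightarrow> real" where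
  "ds_wsum n k s = (\<Sum>m<n. (real k + real m) * (ds_coeff n k m * s ^ m))"

lemma ds_wsum_Suc: "ds_wsum n (Suc k) s = (2 * real k + 1) * ds_sum n (Suc k) s - ds_wsum n k s"
  unfolding ds_wsum_def ds_sum_def sum_distrib_left sum_subtractf[symmetric]
proof (rule sum.cong[OF refl])
  fix m
  have "(real k + real m) * (ds_coeff n k m * s ^ m) = (real k - real m) * ds_coeff n (Suc k) m * s ^ m"
    by (simp add: ds_coeff_shift[symmetric])
  then show "(real (Suc k) + real m) * (ds_coeff n (Suc k) m * s ^ m)
      = (2 * real k + 1) * (ds_coeff n (Suc k) m * s ^ m) - (real k + real m) * (ds_coeff n k m * s ^ m)"
    by (simp add: algebra_simps)
qed

lemma ds_sum_Suc_Suc: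
  assumes "Suc (Suc k) \<le> n"
  shows "(real n ^ 2 - (real k + 1) ^ 2) * ds_sum n (Suc (Suc k)) s
    = (2 * real k + 1) * (s - 1) * (ds_wsum n (Suc k) s - ds_wsum n k s)
      + (real n ^ 2 - real k ^ 2) * ds_sum n k s"
proof -
  obtain N where N: "n = Suc N" "Suc k \<le> N"
    using assms by (cases n) auto
  define f where "f m = (2 * real m + 1) * ds_coeff n (Suc k) m * s ^ m" for m
  have "(real (Suc k) + real m) * (ds_coeff n (Suc k) m * s ^ m)
      - (real k + real m) * (ds_coeff n k m * s ^ m) = f m" for m
  proof -
    have "(real k + real m) * (ds_coeff n k m * s ^ m) = (real k - real m) * ds_coeff n (Suc k) m * s ^ m"
      by (simp add: ds_coeff_shift[symmetric])
    then show ?thesis by (simp add: f_def algebra_simps)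
  qed
  then have w: "ds_wsum n (Suc k) s - ds_wsum n k s = (\<Sum>m<n. f m)"
    by (simp add: ds_wsum_def sum_subtractf[symmetric])
  \<comment> \<open>The top term vanishes, so multiplication by \<open>s\<close> creates no power
    \<open>s^n\<close>.\<close>
  have "f N = 0"
    using N by (simp add: f_def ds_coeff_eq_0)
  then have "s * (\<Sum>m<n. f m) = (\<Sum>m<N. s * f m)"
    by (simp add: N sum_distrib_left)
  moreover have "(\<Sum>m<n. f m) = 1 + (\<Sum>m<N. f (Suc m))"
    unfolding N sum.lessThan_Suc_shift by (simp add: f_def)
  ultimately have s1: "(s - 1) * (\<Sum>m<n. f m) = (\<Sum>m<N. s * f m - f (Suc m)) - 1"
    by (simp add: algebra_simps sum_subtractf)
  have ds: "ds_sum n j s = 1 + (\<Sum>m<N. ds_coeff n j (Suc m) * s ^ Suc m)" for j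
    unfolding ds_sum_def N sum.lessThan_Suc_shift by simp
  have term_eq: "(real n ^ 2 - (real k + 1) ^ 2) * (ds_coeff n (Suc (Suc k)) (Suc m) * s ^ Suc m)
      = (2 * real k + 1) * (s * f m - f (Suc m))
        + (real n ^ 2 - real k ^ 2) * (ds_coeff n k (Suc m) * s ^ Suc m)" if "m < N" for m
  proof -
    have "(real n ^ 2 - (real k + 1) ^ 2) * (ds_coeff n (Suc (Suc k)) (Suc m) * s ^ Suc m)
       = ((real n ^ 2 - (real k + 1) ^ 2) * ds_coeff n (Suc (Suc k)) (Suc m)) * s ^ Suc m"
      by (simp only: mult.assoc)
    also have "\<dots> = (2 * real k + 1) * (s * f m - f (Suc m))
        + (real n ^ 2 - real k ^ 2) * (ds_coeff n k (Suc m) * s ^ Suc m)"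
      using that N by (subst ds_coeff_three_term) (simp_all add: f_def algebra_simps)
    finally show ?thesis .
  qed
  have "(real n ^ 2 - (real k + 1) ^ 2) * ds_sum n (Suc (Suc k)) s
     = (real n ^ 2 - (real k + 1) ^ 2)
       + (\<Sum>m<N. (real n ^ 2 - (real k + 1) ^ 2) * (ds_coeff n (Suc (Suc k)) (Suc m) * s ^ Suc m))"
    unfolding ds by (simp only: distrib_left mult_1_right sum_distrib_left)
  also have "\<dots> = (real n ^ 2 - (real k + 1) ^ 2) + (2 * real k + 1) * (\<Sum>m<N. s * f m - f (Suc m))
        + (real n ^ 2 - real k ^ 2) * (\<Sum>m<N. ds_coeff n k (Suc m) * s ^ Suc m)"
  proof -
    have "(\<Sum>m<N. (real n ^ 2 - (real k + 1) ^ 2) * (ds_coeff n (Suc (Suc k)) (Suc m) * s ^ Suc m))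
      = (\<Sum>m<N. (2 * real k + 1) * (s * f m - f (Suc m))
          + (real n ^ 2 - real k ^ 2) * (ds_coeff n k (Suc m) * s ^ Suc m))"
      by (intro sum.cong refl) (use term_eq in blast)
    then show ?thesis
      by (simp only: sum.distrib sum_distrib_left add.assoc)
  qed
  also have "\<dots> = (2 * real k + 1) * (s - 1) * (\<Sum>m<n. f m) + (real n ^ 2 - real k ^ 2) * ds_sum n k s"
    unfolding ds mult.assoc s1 by (simp add: algebra_simps power2_eq_square)
  finally show ?thesis by (simp only: w)
qed

text \<open>Only \<open>ds_sum\<close> is needed later, but the three-term recurrence in \<open>k\<close> closes only together with the
  inner product of consecutive terms, which is governed by \<open>ds_wsum\<close>.\<close>
lemma ds_identity:
  fixes p q :: "nat \<Rightarrow> real"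
  assumes s: "s * (1 - x^2) = 1"
    and p: "\<And>k. p (Suc (Suc k)) = s * ((2 * real k + 1) * x * p (Suc k) - (real n ^ 2 - real k ^ 2) * p k)"
    and q: "\<And>k. q (Suc (Suc k)) = s * ((2 * real k + 1) * x * q (Suc k) - (real n ^ 2 - real k ^ 2) * q k)"
    and init: "p 0 ^ 2 + q 0 ^ 2 = 1" "p 0 * p 1 + q 0 * q 1 = 0" "p 1 ^ 2 + q 1 ^ 2 = real n ^ 2 * s"
    and "Suc k \<le> n"
  shows "p k ^ 2 + q k ^ 2 = ds_lead n k * s ^ k * ds_sum n k s
    \<and> p k * p (Suc k) + q k * q (Suc k) = ds_lead n k * s ^ Suc k * x * ds_wsum n k s
    \<and> p (Suc k) ^ 2 + q (Suc k) ^ 2 = ds_lead n (Suc k) * s ^ Suc k * ds_sum n (Suc k) s"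
  using \<open>Suc k \<le> n\<close>
proof (induction k)
  case 0
  then obtain N where N: "n = Suc N" by (cases n) auto
  have "ds_sum n 0 s = 1" "ds_wsum n 0 s = 0" "ds_sum n (Suc 0) s = 1"
    unfolding ds_sum_def ds_wsum_def N sum.lessThan_Suc_shift by (simp_all add: ds_coeff_eq_0)
  with init show ?case by (simp add: ds_lead_def)
next
  case (Suc k)
  let ?c = "2 * real k + 1" and ?N = "real n ^ 2 - real k ^ 2"
  define D0 D1 E where "D0 = p k ^ 2 + q k ^ 2" "D1 = p (Suc k) ^ 2 + q (Suc k) ^ 2"
    "E = p k * p (Suc k) + q k * q (Suc k)"
  have IH: "D0 = ds_lead n k * s ^ k * ds_sum n k s"
    "E = ds_lead n k * s ^ Suc k * x * ds_wsum n k s"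
    "D1 = ds_lead n (Suc k) * s ^ Suc k * ds_sum n (Suc k) s"
    using Suc by (simp_all add: D0_D1_E_def)
  have alg1: "a * (s * (c * x * u - N * v)) + b * (s * (c * x * u' - N * v'))
      = s * (c * x * (u * a + u' * b) - N * (v * a + v' * b))" for a b c u v u' v' N :: real
    by (simp add: algebra_simps)
  have alg2: "s * (c * x * ((N * G) * (s * (s * S)) * x * B1)
        - N * (s * (c * x * (G * (s * S) * x * B0) - N * (G * S * A))))
      = (N * G) * (s * (s * S)) * (c * (s * x^2) * (B1 - B0) + N * A)" for c N G S A B0 B1 :: real
    by (simp add: algebra_simps power2_eq_square)
  \<comment> \<open>Turns the remaining \<open>x^2\<close> into the factor \<open>s - 1\<close> of
    \<open>ds_sum_Suc_Suc\<close>.\<close>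
  have xs: "s * x^2 = s - 1"
    using s by (simp add: algebra_simps)
  have "p (Suc k) * p (Suc (Suc k)) + q (Suc k) * q (Suc (Suc k)) = s * (?c * x * D1 - ?N * E)"
    unfolding p q D0_D1_E_def by (simp add: algebra_simps power2_eq_square)
  also have "\<dots> = ds_lead n (Suc k) * s ^ Suc (Suc k) * x * (?c * ds_sum n (Suc k) s - ds_wsum n k s)"
    unfolding IH by (simp add: ds_lead_Suc algebra_simps)
  finally have E1: "p (Suc k) * p (Suc (Suc k)) + q (Suc k) * q (Suc (Suc k))
      = ds_lead n (Suc k) * s ^ Suc (Suc k) * x * ds_wsum n (Suc k) s"
    by (simp only: ds_wsum_Suc)
  have F: "p k * p (Suc (Suc k)) + q k * q (Suc (Suc k)) = s * (?c * x * E - ?N * D0)"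
    unfolding p q D0_D1_E_def by (simp add: algebra_simps power2_eq_square)
  \<comment> \<open>Expanding only one factor of each square leaves two inner products, which
    \<open>E1\<close> and \<open>F\<close> evaluate.\<close>
  have "p (Suc (Suc k)) ^ 2 + q (Suc (Suc k)) ^ 2
      = p (Suc (Suc k)) * (s * (?c * x * p (Suc k) - ?N * p k))
        + q (Suc (Suc k)) * (s * (?c * x * q (Suc k) - ?N * q k))"
    by (simp only: power2_eq_square[of "p (Suc (Suc k))"] power2_eq_square[of "q (Suc (Suc k))"]
        p[symmetric] q[symmetric])
  also have "\<dots> = s * (?c * x * (p (Suc k) * p (Suc (Suc k)) + q (Suc k) * q (Suc (Suc k)))
      - ?N * (p k * p (Suc (Suc k)) + q k * q (Suc (Suc k))))"
    by (rule alg1)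
  also have "\<dots> = ds_lead n (Suc k) * s ^ Suc (Suc k) *
      (?c * (s * x^2) * (ds_wsum n (Suc k) s - ds_wsum n k s) + ?N * ds_sum n k s)"
    unfolding E1 F IH ds_lead_Suc[of n k] power_Suc by (rule alg2)
  also have "\<dots> = ds_lead n (Suc k) * s ^ Suc (Suc k)
      * ((real n ^ 2 - (real k + 1) ^ 2) * ds_sum n (Suc (Suc k)) s)"
    using ds_sum_Suc_Suc[of k n s] Suc.prems by (simp only: xs)
  also have "\<dots> = ds_lead n (Suc (Suc k)) * s ^ Suc (Suc k) * ds_sum n (Suc (Suc k)) s"
    by (simp only: ds_lead_Suc[of n "Suc k"]) (simp add: mult_ac add.commute)
  finally show ?case using IH(3)[unfolded D0_D1_E_def] E1 by (intro conjI)
qed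

text \<open>Each factor of the product in \<open>ds_coeff\<close>, multiplied by \<open>s\<close>,
  lies in \<open>[0, 1]\<close>, so only the central weights survive.\<close>

lemma ds_sum_le:
  assumes "1 \<le> k" "k < n" "0 \<le> s" "s * real k ^ 2 \<le> real n ^ 2"
  shows "ds_sum n k s \<le> 2 * real k * central_weight k"
proof -
  have le: "ds_coeff n k m * s ^ m \<le> central_weight m" if "m < k" for m
  proof -
    have "ds_coeff n k m * s ^ m = central_weight m *
       (\<Prod>j<m. (real k - 1 - real j) * (real k + real j) / (real n ^ 2 - (real j + 1) ^ 2) * s)"
      unfolding ds_coeff_def prod.distrib[of _ "\<lambda>_. s"] by simp
    also have "\<dots> \<le> central_weight m * 1"
    proof (intro mult_left_mono prod_le_1 conjI)
      fix j assume "j \<in> {..<m}"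
      then have j: "real j + 1 \<le> real k - 1" "real k < real n"
        using that assms by auto
      then have nj: "real n ^ 2 - (real j + 1) ^ 2 > 0"
        by (simp add: power_strict_mono)
      show "(real k - 1 - real j) * (real k + real j) / (real n ^ 2 - (real j + 1) ^ 2) * s \<ge> 0"
        using j nj assms(3) by (intro mult_nonneg_nonneg divide_nonneg_pos) auto
      have kj: "0 \<le> real k ^ 2 - (real j + 1) ^ 2"
        using j by (simp add: power_mono)
      have "(real k - 1 - real j) * (real k + real j) * s \<le> (real k ^ 2 - (real j + 1) ^ 2) * s"
        using assms(3) j by (intro mult_right_mono) (simp_all add: algebra_simps power2_eq_square)
      also have "\<dots> \<le> real n ^ 2 - (real j + 1) ^ 2"
      proof -
        \<comment> \<open>Scaling by \<open>k^2\<close> brings in the hypothesis on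
          \<open>s * k^2\<close>; the rest is \<open>k \<le> n\<close>.\<close>
        have "real k ^ 2 * ((real k ^ 2 - (real j + 1) ^ 2) * s)
            = (real k ^ 2 - (real j + 1) ^ 2) * (s * real k ^ 2)"
          by (simp only: mult_ac)
        also have "\<dots> \<le> (real k ^ 2 - (real j + 1) ^ 2) * real n ^ 2"
          by (rule mult_left_mono[OF assms(4) kj])
        also have "\<dots> \<le> real k ^ 2 * (real n ^ 2 - (real j + 1) ^ 2)"
        proof -
          have "(real j + 1) ^ 2 * real k ^ 2 \<le> (real j + 1) ^ 2 * real n ^ 2"
            using j by (intro mult_left_mono power_mono) auto
          then show ?thesis by (simp add: left_diff_distrib right_diff_distrib mult.commute)
        qed
        finally show ?thesis
          using assms(1) by (simp add: mult_le_cancel_left_pos)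
      qed
      finally show "(real k - 1 - real j) * (real k + real j) / (real n ^ 2 - (real j + 1) ^ 2) * s \<le> 1"
        using nj by (simp add: pos_divide_le_eq)
    qed (use central_weight_pos[of m] in simp)
    finally show ?thesis by simp
  qed
  have "ds_sum n k s = (\<Sum>m<k. ds_coeff n k m * s ^ m)"
    unfolding ds_sum_def using assms by (intro sum.mono_neutral_right) (auto simp: ds_coeff_eq_0)
  also have "\<dots> \<le> (\<Sum>m<k. central_weight m)"
    by (intro sum_mono) (use le in auto)
  finally show ?thesis by (simp only: sum_central_weight)
qed

text \<open>The conjugate of \<open>T_n^(k)\<close>: with the initial values chosen below it takes the values of the
  derivatives of \<open>sin (n * arccos x)\<close> (up to sign).\<close>
fun ds_conj :: "nat \<Rightarrow> real \<Rightarrow> real \<Rightarrow> real \<Rightarrow> nat \<Rightarrow> real" where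
  "ds_conj n x a b 0 = a"
| "ds_conj n x a b (Suc 0) = b"
| "ds_conj n x a b (Suc (Suc k)) = 1 / (1 - x^2) *
    ((2 * real k + 1) * x * ds_conj n x a b (Suc k) - (real n ^ 2 - real k ^ 2) * ds_conj n x a b k)"

lemma cheb_deriv_sq_le:
  assumes "x^2 < 1" "k < n"
  shows "poly (cheb_deriv n k) x ^ 2 \<le> ds_lead n k * (1 / (1 - x^2)) ^ k * ds_sum n k (1 / (1 - x^2))"
proof -
  let ?p = "\<lambda>k. poly (cheb_deriv n k) x"
  define s where "s = 1 / (1 - x^2)"
  define r where "r = sqrt (1 - x^2)"
  have r: "r > 0" "r ^ 2 = 1 - x^2"
    using assms(1) by (simp_all add: r_def)
  have s: "s * r^2 = 1" using r assms(1) by (simp add: s_def)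
  have n: "real n > 0" using assms by simp
  \<comment> \<open>At \<open>x = cos t\<close> with \<open>0 < t < pi\<close> the initial values
    are \<open>sin (n t)\<close> and its derivative in \<open>x\<close>.\<close>
  define q where "q = ds_conj n x (r * ?p 1 / real n) (- real n * ?p 0 / r)"
  have pell: "real n ^ 2 * ?p 0 ^ 2 + r^2 * ?p 1 ^ 2 = real n ^ 2"
    using cheb_pell[of x n] assms(1) r by (simp add: cheb_deriv_def)
  have "?p k ^ 2 + q k ^ 2 = ds_lead n k * s ^ k * ds_sum n k s"
  proof (rule ds_identity[THEN conjunct1])
    show "s * (1 - x^2) = 1" using s r by simp
    show "?p (Suc (Suc k)) = s * ((2 * real k + 1) * x * ?p (Suc k) - (real n ^ 2 - real k ^ 2) * ?p k)" for k
      unfolding cheb_deriv_ode[symmetric] using s r by (simp add: mult.assoc[symmetric])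
    show "q (Suc (Suc k)) = s * ((2 * real k + 1) * x * q (Suc k) - (real n ^ 2 - real k ^ 2) * q k)" for k
      by (simp add: q_def s_def)
    show "?p 0 ^ 2 + q 0 ^ 2 = 1"
      using pell n by (simp add: q_def field_simps)
    show "?p 0 * ?p 1 + q 0 * q 1 = 0"
      using n r by (simp add: q_def field_simps)
    have "?p 1 ^ 2 + q 1 ^ 2 = (real n ^ 2 * ?p 0 ^ 2 + r^2 * ?p 1 ^ 2) * s"
      using r s by (simp add: q_def s_def field_simps)
    then show "?p 1 ^ 2 + q 1 ^ 2 = real n ^ 2 * s"
      by (simp only: pell)
  qed (use assms in auto)
  then show ?thesis
    unfolding s_def using zero_le_power2[of "q k"] by linarith
qed

section \<open>The largest critical value\<close>

text \<open>If \<open>omega\<close> were closer to 1, \<open>cheb_deriv_pos\<close> would make the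
  derivative positive at its own zero.\<close>

lemma omega_props:
  assumes "k + 2 \<le> n"
  shows "omega n k ^ 2 < 1" "(real k + 1) ^ 2 \<le> (1 - omega n k ^ 2) * real n ^ 2"
proof -
  let ?P = "cheb_deriv n (k + 1)" and ?w = "omega n k"
  define Z where "Z = {x. poly ?P x = 0}"
  have "?P \<noteq> 0"
    using cheb_deriv_1_pos[of "k + 1" n] assms by auto
  then have fin: "finite Z"
    unfolding Z_def by (rule poly_roots_finite)
  obtain c where c: "-1 < c" "c < 1" "c \<in> Z"
    using cheb_deriv_has_root[of "k + 1" n] assms by (auto simp: Z_def)
  have w: "?w = Max Z"
    by (simp add: omega_def Z_def)
  then have wZ: "?w \<in> Z"
    using Max_in[OF fin] c by auto
  then have "- ?w \<in> Z"
    using cheb_deriv_uminus_root by (simp add: Z_def)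
  then have "- ?w \<le> ?w"
    using Max_ge[OF fin] unfolding w by blast
  then have w0: "0 \<le> ?w" by simp
  have n: "real n \<ge> real k + 2" using assms by linarith
  have sq: "(real k + 2) ^ 2 \<le> real n ^ 2"
    using n by (intro power_mono) auto
  have "(real k + 2)^2 - 1/4 \<le> (1 - ?w^2) * (real n ^ 2 - 1/4)"
  proof (cases "?w = 0")
    \<comment> \<open>\<open>cheb_deriv_pos\<close> requires a positive argument, so the zero at the
      origin is settled by \<open>k + 2 \<le> n\<close>.\<close>
    case True
    then show ?thesis using sq by simp
  next
    case False
    then show ?thesis
      using cheb_deriv_pos[of "k + 1" n ?w] w0 wZ assms by (force simp: Z_def add_ac)
  qed
  moreover have "(real k + 2)^2 - 1/4 \<ge> (real k + 1)^2" "(real k + 1)^2 > 0"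
    using zero_less_power[of "real k + 1" 2] by (simp_all add: power2_eq_square algebra_simps)
  ultimately have gt: "(real k + 1)^2 \<le> (1 - ?w^2) * (real n ^ 2 - 1/4)" "0 < (1 - ?w^2) * (real n ^ 2 - 1/4)"
    by linarith+
  have "real n ^ 2 - 1/4 > 0"
  proof -
    have "4 \<le> (real k + 2) ^ 2" by (simp add: power2_eq_square algebra_simps)
    with sq show ?thesis by linarith
  qed
  with gt(2) show w1: "?w ^ 2 < 1"
    by (simp add: zero_less_mult_iff)
  then have "(1 - ?w^2) * (real n ^ 2 - 1/4) \<le> (1 - ?w^2) * real n ^ 2"
    by (intro mult_left_mono) auto
  with gt(1) show "(real k + 1) ^ 2 \<le> (1 - ?w^2) * real n ^ 2"
    by linarith
qed

text \<open>The factor in parentheses is \<open>(2k-1)!!\<close>.\<close>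

lemma cheb_deriv_1:
  "poly (cheb_deriv n k) 1 * (2 ^ k * fact k * central_weight k) = ds_lead n k"
proof (induction k)
  case 0
  then show ?case by (simp add: cheb_deriv_def cheb_1 central_weight_def ds_lead_def)
next
  case (Suc k)
  have "2 ^ Suc k * fact (Suc k) * central_weight (Suc k)
     = (2 * real k + 1) * (2 ^ k * fact k * central_weight k)"
    by (simp add: central_weight_Suc divide_simps)
  then have "poly (cheb_deriv n (Suc k)) 1 * (2 ^ Suc k * fact (Suc k) * central_weight (Suc k))
     = ((2 * real k + 1) * poly (cheb_deriv n (Suc k)) 1) * (2 ^ k * fact k * central_weight k)"
    by (simp only: mult_ac)
  also have "\<dots> = ds_lead n (Suc k)"
    unfolding cheb_deriv_1_Suc ds_lead_Suc Suc[symmetric] by (simp only: mult_ac)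
  finally show ?case .
qed

text \<open>Splitting \<open>n^2 - j^2\<close> as \<open>(n - j) * (n + j)\<close> yields two
  falling products, prepared here for Stirling.\<close>

lemma ds_lead_fact:
  assumes "k < n"
  shows "ds_lead n k * (real n + real k) * fact (n - k) = real n * fact (n + k)"
  using assms
proof (induction k)
  case 0
  then show ?case by (simp add: ds_lead_def)
next
  case (Suc k)
  then have nk: "n - k = Suc (n - Suc k)" "real (n - k) = real n - real k" by simp_all
  have "ds_lead n (Suc k) * (real n + real (Suc k)) * fact (n - Suc k)
     = (ds_lead n k * (real n + real k) * ((real n - real k) * fact (n - Suc k))) * (real n + real (Suc k))"
    by (simp add: ds_lead_Suc power2_eq_square algebra_simps)
  also have "(real n - real k) * fact (n - Suc k) = fact (n - k)"
    unfolding nk(2)[symmetric] unfolding nk(1) fact_Suc by simp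
  also have "ds_lead n k * (real n + real k) * fact (n - k) = real n * fact (n + k)"
    using Suc by simp
  finally show ?case by (simp add: algebra_simps)
qed

lemma tau_sq_le:
  assumes "1 \<le> k" "k + 2 \<le> n"
  shows "tau n k ^ 2 \<le> 4 ^ k * fact k ^ 2 / sqrt (2 * real k)
     * (real n / (real k + 1)) ^ (2 * k) / ds_lead n k"
proof -
  let ?w = "omega n k" and ?c = "central_weight k" and ?P = "poly (cheb_deriv n k) 1"
  define s where "s = 1 / (1 - ?w ^ 2)"
  have w: "?w ^ 2 < 1" "(real k + 1) ^ 2 \<le> (1 - ?w ^ 2) * real n ^ 2"
    using omega_props[OF assms(2)] by blast+
  have s0: "s > 0" using w by (simp add: s_def)
  have s1: "s * (real k + 1) ^ 2 \<le> real n ^ 2"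
    using w by (simp add: s_def field_simps)
  have "s * real k ^ 2 \<le> s * (real k + 1) ^ 2"
    using s0 by (simp add: power_mono)
  with s1 have sk: "s * real k ^ 2 \<le> real n ^ 2" by linarith
  have G: "ds_lead n k > 0" using assms by (simp add: ds_lead_pos)
  have P: "?P > 0" using assms by (simp add: cheb_deriv_1_pos)
  have c: "?c > 0" by (rule central_weight_pos)
  have "s \<le> (real n / (real k + 1)) ^ 2"
    using s1 by (simp add: power_divide pos_le_divide_eq)
  then have sp: "s ^ k \<le> (real n / (real k + 1)) ^ (2 * k)"
    unfolding power_mult using s0 by (intro power_mono) auto
  have "?c ^ 2 * (2 * real k) \<le> 1"
  proof -
    have "?c ^ 2 * (2 * real k) \<le> (2 * real k + 1) * ?c ^ 2"
      by (simp add: algebra_simps)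
    with central_weight_sq_le[of k] show ?thesis by linarith
  qed
  moreover have "?c \<le> 1 / sqrt (2 * real k)"
  proof -
    have "?c * sqrt (2 * real k) = sqrt (?c ^ 2 * (2 * real k))"
      using c by (simp add: real_sqrt_mult)
    also have "\<dots> \<le> 1"
      using \<open>?c ^ 2 * (2 * real k) \<le> 1\<close> by simp
    finally show ?thesis
      using assms by (simp add: pos_le_divide_eq)
  qed
  \<comment> \<open>One weight comes from the majorant sum and two from normalising by the endpoint
    value.\<close>
  ultimately have cc: "(?c ^ 2 * (2 * real k)) * ?c \<le> 1 * (1 / sqrt (2 * real k))"
    using c by (intro mult_mono) auto
  have "tau n k ^ 2 = poly (cheb_deriv n k) ?w ^ 2 / ?P ^ 2"
    by (simp add: tau_def power_divide)
  also have "\<dots> \<le> ds_lead n k * s ^ k * ds_sum n k s / ?P ^ 2"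
    using cheb_deriv_sq_le[OF w(1), of k n] assms P by (intro divide_right_mono) (auto simp: s_def)
  also have "\<dots> \<le> ds_lead n k * s ^ k * (2 * real k * ?c) / ?P ^ 2"
    using ds_sum_le[of k n s] assms s0 sk G by (intro divide_right_mono mult_left_mono) auto
  also have "\<dots> = (4 ^ k * fact k ^ 2 / ds_lead n k) * (((?c ^ 2 * (2 * real k)) * ?c) * s ^ k)"
  proof -
    define u where "u = 2 ^ k * fact k * ?c"
    have u: "u > 0" using c by (simp add: u_def)
    have "?P = ds_lead n k / u"
      using cheb_deriv_1[of n k, folded u_def] u by (simp add: field_simps)
    moreover have "g * a * b / (g / u) ^ 2 = u ^ 2 / g * (a * b)" if "g > 0" for g a b
      using that u by (simp add: power2_eq_square)
    ultimately have "ds_lead n k * s ^ k * (2 * real k * ?c) / ?P ^ 2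
        = u ^ 2 / ds_lead n k * (s ^ k * (2 * real k * ?c))"
      using G by simp
    also have "u ^ 2 = 4 ^ k * fact k ^ 2 * ?c ^ 2"
      using power_mult_distrib[of 2 "2 :: real" k]
      by (simp add: u_def power2_eq_square mult_ac)
    finally show ?thesis by (simp only: mult_ac times_divide_eq_right times_divide_eq_left)
  qed
  also have "\<dots> \<le> (4 ^ k * fact k ^ 2 / ds_lead n k)
      * (1 * (1 / sqrt (2 * real k)) * (real n / (real k + 1)) ^ (2 * k))"
  proof (rule mult_left_mono)
    show "((?c ^ 2 * (2 * real k)) * ?c) * s ^ k
        \<le> 1 * (1 / sqrt (2 * real k)) * (real n / (real k + 1)) ^ (2 * k)"
      by (rule mult_mono[OF cc sp]) (use s0 in auto)
  qed (use G in simp)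
  finally show ?thesis by (simp add: mult.commute)
qed

section \<open>Stirling bounds and the logarithmic estimate\<close>

text \<open>The Stirling remainder \<open>L\<close> decreases from \<open>L 1 = 1\<close>; midpoint
  and trapezoidal bounds for \<open>ln\<close> control its decrements. The term
  \<open>1 / (4 * j)\<close> makes the lower bound inductive.\<close>

lemma ln_fact_bounds:
  assumes "1 \<le> j"
  shows "ln (fact j) \<le> 1 + (real j + 1/2) * ln (real j) - real j"
    and "3/4 + (real j + 1/2) * ln (real j) - real j \<le> ln (fact j)"
proof -
  define L where "L j = ln (fact j) - (real j + 1/2) * ln (real j) + real j" for j
  have "L j \<le> 1 \<and> 3/4 + 1 / (4 * real j) \<le> L j"
    using assms
  proof (induction j rule: dec_induct)
    case base
    then show ?case by (simp add: L_def)
  next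
    case (step j)
    define d where "d = ln (real j + 1) - ln (real j)"
    have j: "real j > 0" using step by simp
    have "L (Suc j) = L j + 1 - (real j + 1/2) * d"
    proof -
      have "ln (fact (Suc j)) = ln (real j + 1) + ln (fact j)" "real (Suc j) = real j + 1"
        using j by (simp_all add: ln_mult_pos add.commute)
      then show ?thesis
        unfolding L_def d_def by (simp only: algebra_simps)
    qed
    moreover have "2 / (2 * real j + 1) \<le> d"
      using ln_inverse_approx_ge[of "real j" "real j + 1"] j by (simp add: d_def)
    then have "(real j + 1/2) * d \<ge> 1"
      using j by (simp add: field_simps)
    moreover have "(real j + 1/2) * d \<le> 1 + 1 / (4 * real j) - 1 / (4 * real (Suc j))"
    proof -
      have "(real j + 1/2) * d \<le> (real j + 1/2) * ((inverse (real j) + inverse (real j + 1)) / 2)"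
        using ln_inverse_approx_le[of "real j" 1] j by (intro mult_left_mono) (simp_all add: d_def)
      also have "\<dots> = 1 + 1 / (4 * real j) - 1 / (4 * real (Suc j))"
        using j by (simp add: divide_simps) (simp add: algebra_simps)
      finally show ?thesis .
    qed
    ultimately show ?case
      using step.IH by linarith
  qed
  moreover have "0 \<le> 1 / (4 * real j)" by simp
  ultimately have "L j \<le> 1" "3/4 \<le> L j" by linarith+
  then show "ln (fact j) \<le> 1 + (real j + 1/2) * ln (real j) - real j"
    "3/4 + (real j + 1/2) * ln (real j) - real j \<le> ln (fact j)"
    by (simp_all add: L_def)
qed

text \<open>The exponential of this is
  \<open>exp (9/4) / (4 * sqrt 2) * sqrt (k * (n\<^sup>2 - k\<^sup>2)) / n * 4^k * n^(2*k) * (n-k)^(n-k) / (n+k)^(n+k)\<close>,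
  the common source of all the estimates of \<open>tau\<^sup>2\<close>.\<close>
definition log_bound :: "real \<Rightarrow> real \<Rightarrow> real" where
  "log_bound n k = 9/4 - 5/2 * ln 2 + ln k / 2 + ln (n + k) / 2 + ln (n - k) / 2 - ln n
     + 2 * k * ln 2 + 2 * k * ln n + (n - k) * ln (n - k) - (n + k) * ln (n + k)"

section \<open>Special forms of the logarithmic bound\<close>

lemma ln_add_ln_diff_le:
  fixes n k :: real
  assumes "0 \<le> k" "k < n"
  shows "ln (n + k) + ln (n - k) \<le> 2 * ln n"
proof -
  have "ln (n + k) + ln (n - k) = ln ((n + k) * (n - k))"
    using assms by (simp add: ln_mult_pos)
  also have "\<dots> \<le> ln (n * n)"
    using assms by (subst ln_le_cancel_iff) (auto simp: algebra_simps zero_less_mult_iff mult_strict_mono)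
  finally show ?thesis
    using assms by (simp add: ln_mult_pos)
qed

lemma log_bound_le:
  assumes "0 < k" "k < n"
  shows "log_bound n k \<le> 9/4 - 5/2 * ln 2 + ln k / 2 + 2 * k * ln 2 - 2 * k
    - k * (ln (n + k) + ln (n - k) - 2 * ln n)"
proof -
  have "2 * k / n \<le> ln (n + k) - ln (n - k)"
    using ln_inverse_approx_ge[of "n - k" "n + k"] assms by simp
  then have "2 * k \<le> n * (ln (n + k) - ln (n - k))"
    using assms by (simp add: field_simps)
  moreover have "ln (n + k) + ln (n - k) \<le> 2 * ln n"
    using assms by (simp add: ln_add_ln_diff_le)
  ultimately show ?thesis
    unfolding log_bound_def by (simp add: algebra_simps)
qed

text \<open>With \<open>n + k = 2 * n - m\<close> the terms of order \<open>n * ln n\<close> cancel,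
  at a cost of at most \<open>m\<close>.\<close>

lemma log_bound_diff_le:
  assumes "0 < m" "m < n"
  shows "log_bound n (n - m) \<le> 9/4 - 2 * ln 2 + ln m / 2 + m * (ln m + 1 - ln 2) - m * ln n"
proof -
  have "ln (2 * n) - ln (2 * n - m) = ln (2 * n / (2 * n - m))"
    using assms by (simp add: ln_div)
  also have "\<dots> \<le> 2 * n / (2 * n - m) - 1"
    using assms by (intro ln_le_minus_one) auto
  also have "\<dots> = m / (2 * n - m)"
    using assms by (simp add: field_simps)
  finally have "(2 * n - m) * (ln (2 * n) - ln (2 * n - m)) \<le> m"
    using assms by (simp add: field_simps)
  moreover have n2: "ln (2 * n) = ln 2 + ln n"
    using assms by (simp add: ln_mult_pos)
  moreover have "ln (n - m) \<le> ln n" "ln (2 * n - m) \<le> ln (2 * n)"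
    using assms by auto
  ultimately show ?thesis
    unfolding log_bound_def by (simp add: algebra_simps)
qed

lemma log_bound_double:
  assumes "0 < k"
  shows "log_bound (2 * k) k
    = 9/4 - 7/2 * ln 2 + ln 3 / 2 + ln k / 2 + k * (4 * ln 2 - 3 * ln 3)"
proof -
  have "ln (2 * k) = ln 2 + ln k" "ln (2 * k + k) = ln 3 + ln k" "2 * k - k = k"
    using assms using ln_mult_pos[of 3 k] by (simp_all add: ln_mult_pos)
  then show ?thesis
    unfolding log_bound_def by (simp add: algebra_simps)
qed

text \<open>The exponential rate of \<open>tau\<^sup>2\<close> in \<open>n\<close> when \<open>k = t * n\<close>.\<close>
definition rate :: "real \<Rightarrow> real" where
  "rate t = 2 * t * ln 2 + (1 - t) * ln (1 - t) - (1 + t) * ln (1 + t)"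

text \<open>Concavity of the logarithm at the points \<open>1 - t < 1 + t < 2\<close>, through the tangent at \<open>1 + t\<close>.\<close>
lemma rate_neg:
  assumes "0 < t" "t < 1"
  shows "rate t < 0"
proof -
  have 1: "ln (1 - t) - ln (1 + t) \<le> - 2 * t / (1 + t)"
  proof -
    have "ln ((1 - t) / (1 + t)) \<le> (1 - t) / (1 + t) - 1"
      using assms by (intro ln_le_minus_one) auto
    also have "\<dots> = - 2 * t / (1 + t)"
      using assms by (simp add: field_simps)
    finally show ?thesis
      using assms by (simp add: ln_div)
  qed
  have 2: "ln 2 - ln (1 + t) < (1 - t) / (1 + t)"
  proof -
    have "2 / (1 + t) \<noteq> 1" "2 / (1 + t) > 0"
      using assms by auto
    then have "ln (2 / (1 + t)) < 2 / (1 + t) - 1"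
      using ln_le_minus_one[of "2 / (1 + t)"] ln_eq_minus_one[of "2 / (1 + t)"] by fastforce
    also have "\<dots> = (1 - t) / (1 + t)"
      using assms by (simp add: field_simps)
    finally show ?thesis
      using assms by (simp add: ln_div)
  qed
  have "rate t = (1 - t) * (ln (1 - t) - ln (1 + t)) + 2 * t * (ln 2 - ln (1 + t))"
    by (simp add: rate_def algebra_simps)
  also have "\<dots> < (1 - t) * (- 2 * t / (1 + t)) + 2 * t * ((1 - t) / (1 + t))"
    using 1 2 assms by (intro add_le_less_mono mult_left_mono mult_strict_left_mono) auto
  also have "\<dots> = 0"
    using assms by (simp add: field_simps)
  finally show ?thesis .
qed

text \<open>Compactness: \<open>rate\<close> attains its maximum on \<open>[a, b]\<close>, and that
  value is negative.\<close>

lemma rate_uniform: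
  assumes "0 < a" "a \<le> b" "b < 1"
  obtains c where "c < 0" "\<And>t. a \<le> t \<Longrightarrow> t \<le> b \<Longrightarrow> rate t \<le> c"
proof -
  have "continuous_on {a..b} rate"
    unfolding rate_def using assms by (intro continuous_intros) auto
  then obtain u where "u \<in> {a..b}" "\<forall>t\<in>{a..b}. rate t \<le> rate u"
    using continuous_attains_sup[of "{a..b}" rate] assms by auto
  then show ?thesis
    using that[of "rate u"] rate_neg[of u] assms by auto
qed

lemma log_bound_rate:
  assumes "0 < k" "k < n"
  shows "log_bound n k \<le> 9/4 - 5/2 * ln 2 + ln n / 2 + n * rate (k / n)"
proof -
  have "1 - k / n = (n - k) / n" "1 + k / n = (n + k) / n"
    using assms by (simp_all add: field_simps)
  then have l: "ln (1 - k / n) = ln (n - k) - ln n" "ln (1 + k / n) = ln (n + k) - ln n"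
    using assms by (simp_all add: ln_div)
  have "n * rate (k / n) = 2 * k * ln 2 + (n - k) * (ln (n - k) - ln n) - (n + k) * (ln (n + k) - ln n)"
  proof -
    have "n * rate (k / n) = 2 * (n * (k / n)) * ln 2 + (n * (1 - k / n)) * ln (1 - k / n)
        - (n * (1 + k / n)) * ln (1 + k / n)"
      by (simp only: rate_def algebra_simps)
    moreover have "n * (k / n) = k" "n * (1 - k / n) = n - k" "n * (1 + k / n) = n + k"
      using assms by (simp_all add: field_simps)
    ultimately show ?thesis
      using l by (simp only:)
  qed
  moreover have "ln k \<le> ln n" "ln (n + k) + ln (n - k) \<le> 2 * ln n"
    using assms by (auto intro: ln_add_ln_diff_le)
  ultimately show ?thesis
    unfolding log_bound_def by (simp add: algebra_simps)
qed

text \<open>The constant \<open>9/4 = 2 + 1 - 3/4\<close> collects the Stirling errors of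
  \<open>fact k\<close> squared, \<open>fact (n - k)\<close> and \<open>fact (n + k)\<close>;
  \<open>5/2 * ln 2\<close> comes from \<open>sqrt (2 * k)\<close> and the Bernoulli step.\<close>

lemma tau_le:
  assumes "1 \<le> k" "k + 2 \<le> n"
  shows "tau n k \<le> exp (log_bound (real n) (real k) / 2)"
proof -
  let ?N = "real n" and ?K = "real k"
  let ?R = "4 ^ k * fact k ^ 2 / sqrt (2 * ?K) * (?N / (?K + 1)) ^ (2 * k) / ds_lead n k"
  have k: "?K > 0" and nk: "?K < ?N" using assms by simp_all
  have G: "ds_lead n k > 0" using assms by (simp add: ds_lead_pos)
  have "ln (ds_lead n k * (?N + ?K) * fact (n - k)) = ln (?N * fact (n + k))"
    using ds_lead_fact[of k n] assms by simp
  then have lnG: "ln (ds_lead n k) + ln (?N + ?K) + ln (fact (n - k)) = ln ?N + ln (fact (n + k))"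
    using G k nk by (simp add: ln_mult_pos)
  \<comment> \<open>Keeping \<open>k + 1\<close> in the bound for \<open>omega\<close> gains this
    factor 2, squared in \<open>tau^2\<close>.\<close>
  have "2 * ?K ^ k \<le> (?K + 1) ^ k"
  proof -
    have "1 + real k * (1 / ?K) \<le> (1 + 1 / ?K) ^ k"
      by (rule Bernoulli_inequality) (use k in \<open>simp add: field_simps\<close>)
    then have "2 * ?K ^ k \<le> (1 + 1 / ?K) ^ k * ?K ^ k"
      using k by (intro mult_right_mono) auto
    also have "\<dots> = (?K + 1) ^ k"
    proof -
      have "(1 + 1 / ?K) * ?K = ?K + 1" using k by (simp add: field_simps)
      then show ?thesis by (simp only: power_mult_distrib[symmetric])
    qed
    finally show ?thesis .
  qed
  then have "ln (2 * ?K ^ k) \<le> ln ((?K + 1) ^ k)"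
    using k by (subst ln_le_cancel_iff) auto
  then have lnk: "ln 2 + ?K * ln ?K \<le> ?K * ln (?K + 1)"
    using k by (simp add: ln_mult_pos ln_realpow)
  have R: "?R > 0"
    using G k nk by simp
  have "ln ?R = ?K * ln 4 + 2 * ln (fact k) - ln (2 * ?K) / 2 + 2 * ?K * (ln ?N - ln (?K + 1)) - ln (ds_lead n k)"
    using G k nk by (simp add: ln_mult_pos ln_div ln_realpow ln_sqrt)
  also have "ln (4::real) = 2 * ln 2"
    using ln_realpow[of 2 2] by simp
  also have "ln (2 * ?K) = ln 2 + ln ?K"
    using k by (simp add: ln_mult_pos)
  finally have "ln ?R = 2 * ?K * ln 2 + 2 * ln (fact k) - ln 2 / 2 - ln ?K / 2
      + 2 * ?K * ln ?N - 2 * (?K * ln (?K + 1)) - ln (ds_lead n k)"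
    by (simp add: algebra_simps add_divide_distrib)
  moreover note lnG lnk
  moreover have "ln (fact k) \<le> 1 + (?K * ln ?K + ln ?K / 2) - ?K"
    using ln_fact_bounds(1)[of k] assms by (simp add: algebra_simps)
  moreover have "3/4 + ((?N + ?K) * ln (?N + ?K) + ln (?N + ?K) / 2) - (?N + ?K) \<le> ln (fact (n + k))"
    using ln_fact_bounds(2)[of "n + k"] assms by (simp add: algebra_simps)
  moreover have "ln (fact (n - k)) \<le> 1 + ((?N - ?K) * ln (?N - ?K) + ln (?N - ?K) / 2) - (?N - ?K)"
    using ln_fact_bounds(1)[of "n - k"] assms by (simp add: of_nat_diff algebra_simps)
  ultimately have "ln ?R \<le> log_bound ?N ?K"
    unfolding log_bound_def by linarith
  then have "?R \<le> exp (log_bound ?N ?K)"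
    using R by (metis exp_ln exp_le_cancel_iff)
  then have "tau n k ^ 2 \<le> exp (log_bound ?N ?K / 2) ^ 2"
    using tau_sq_le[OF assms] by (simp flip: exp_double)
  then show ?thesis
    by (rule power2_le_imp_le) simp
qed

section \<open>The estimates of the theorem\<close>

lemma c1_eq: "c1 = exp (1 - ln 2 / 2 - ln pi / 4)"
proof -
  have "exp 2 / (2 * sqrt pi) = exp (ln (exp 2 / (2 * sqrt pi)))"
    by simp
  also have "ln (exp 2 / (2 * sqrt pi)) = 2 * (1 - ln 2 / 2 - ln pi / 4)"
    by (simp add: ln_div ln_mult_pos ln_sqrt)
  finally have "exp 2 / (2 * sqrt pi) = exp (2 * (1 - ln 2 / 2 - ln pi / 4))" .
  then show ?thesis
    unfolding c1_def by (simp only: exp_double real_sqrt_abs abs_exp_cancel)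
qed

lemma ln_2_ge_half: "1/2 \<le> ln (2::real)"
  using ln_le_minus_one[of "1/2 :: real"] by (simp add: ln_div)

lemma ln_less_ln_4: "0 < x \<Longrightarrow> x < 4 \<Longrightarrow> ln x < 2 * ln (2::real)"
  using ln_realpow[of 2 2] ln_less_cancel_iff[of x 4] by simp

lemma tau_upper:
  assumes "1 \<le> k" "k + 2 \<le> n"
  shows "tau n k \<le> c1 * (2 / exp 1) ^ k * real k powr (1/4)
                    / (1 - real k ^ 2 / real n ^ 2) powr (real k / 2)"
proof -
  let ?N = "real n" and ?K = "real k"
  have k: "0 < ?K" "?K < ?N" using assms by auto
  have q: "1 - ?K ^ 2 / ?N ^ 2 = (?N + ?K) * (?N - ?K) / (?N * ?N)"
    using k by (simp add: field_simps power2_eq_square)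
  have lq: "ln (1 - ?K ^ 2 / ?N ^ 2) = ln (?N + ?K) + ln (?N - ?K) - 2 * ln ?N"
    unfolding q using k by (simp add: ln_div ln_mult_pos)
  have q0: "1 - ?K ^ 2 / ?N ^ 2 > 0"
    unfolding q using k by simp
  \<comment> \<open>As \<open>pi < 4\<close>, the constants compare once
    \<open>9/8 - 5/4 * ln 2 \<le> 1 - ln 2\<close>, that is \<open>1/2 \<le> ln 2\<close>.\<close>
  have "log_bound ?N ?K / 2 \<le> (1 - ln 2 / 2 - ln pi / 4) + ?K * (ln 2 - 1) + ln ?K / 4
      - ?K / 2 * ln (1 - ?K ^ 2 / ?N ^ 2)"
    using log_bound_le[OF k] ln_2_ge_half ln_less_ln_4[of pi] pi_less_4 unfolding lq
    by (simp add: algebra_simps)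
  then have "exp (log_bound ?N ?K / 2) \<le> exp ((1 - ln 2 / 2 - ln pi / 4) + ?K * (ln 2 - 1) + ln ?K / 4
      - ?K / 2 * ln (1 - ?K ^ 2 / ?N ^ 2))"
    by simp
  also have "\<dots> = c1 * (2 / exp 1) ^ k * ?K powr (1/4) / (1 - ?K ^ 2 / ?N ^ 2) powr (?K / 2)"
    using k q0 unfolding exp_add exp_diff c1_eq exp_of_nat_mult powr_def by simp
  finally show ?thesis
    using tau_le[OF assms] by linarith
qed

lemma tau_upper_large:
  assumes "1 \<le> k" "k + 2 \<le> n" "real k powr (3/2) \<le> real n"
  shows "tau n k < (2 * c1 * exp 1) * (2 / exp 1) ^ k * real k powr (1/4)"
proof -
  let ?N = "real n" and ?K = "real k"
  have k: "1 \<le> ?K" "?K + 2 \<le> ?N" using assms by auto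
  define q where "q = ?K ^ 2 / ?N ^ 2"
  have q0: "0 < q" using k by (simp add: q_def)
  have "(?K powr (3/2)) ^ 2 \<le> ?N ^ 2"
    using assms by (intro power_mono) auto
  moreover have "(?K powr (3/2)) ^ 2 = ?K ^ 2 * ?K"
    using k powr_realpow[of ?K 3] by (simp add: power2_eq_square power3_eq_cube flip: powr_add)
  ultimately have qK: "?K * q \<le> 1"
    using k by (simp add: q_def field_simps)
  \<comment> \<open>Equivalent to \<open>k/2 * q / (1 - q) \<le> 1\<close>, which bounds
    \<open>(1 - q) powr (- k/2)\<close> by \<open>exp 1\<close>. For \<open>k = 1\<close> it uses
    \<open>3 \<le> n\<close>.\<close>
  have "(?K + 2) * q \<le> 2"
  proof (cases "k = 1")
    case True
    have "3 ^ 2 \<le> ?N ^ 2" using k True by (intro power_mono) auto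
    then have "1 / ?N ^ 2 \<le> 1 / 9" using k by (intro divide_left_mono) auto
    then show ?thesis using True by (simp add: q_def)
  next
    case False
    then have "2 \<le> ?K" using assms by simp
    then have "2 * q \<le> ?K * q" using q0 by (intro mult_right_mono) auto
    with qK show ?thesis by (simp add: algebra_simps)
  qed
  then have Kq: "?K * q \<le> 2 * (1 - q)" by (simp add: algebra_simps)
  then have q1: "1 - q > 0"
    using q0 k by (smt (verit) mult_pos_pos)
  have "- ln (1 - q) = ln (1 / (1 - q))"
    using q1 by (simp add: ln_div)
  also have "\<dots> \<le> 1 / (1 - q) - 1"
    using q1 by (intro ln_le_minus_one) auto
  also have "\<dots> = q / (1 - q)"
    using q1 by (simp add: field_simps)
  finally have "?K / 2 * (- ln (1 - q)) \<le> ?K / 2 * (q / (1 - q))"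
    using k by (intro mult_left_mono) auto
  also have "\<dots> \<le> 1"
    using Kq q1 by (simp add: field_simps)
  finally have "exp (- 1) \<le> (1 - q) powr (?K / 2)"
    using q1 by (simp add: powr_def)
  then have le: "1 / (1 - q) powr (?K / 2) \<le> exp 1"
    using q1 by (simp add: exp_minus field_simps)
  have pos: "c1 * (2 / exp 1) ^ k * ?K powr (1/4) > 0"
    using k by (simp add: c1_eq)
  have "tau n k \<le> c1 * (2 / exp 1) ^ k * ?K powr (1/4) * (1 / (1 - q) powr (?K / 2))"
    using tau_upper[OF assms(1,2)] by (simp add: q_def)
  also have "\<dots> \<le> c1 * (2 / exp 1) ^ k * ?K powr (1/4) * exp 1"
    using le pos by (intro mult_left_mono) auto
  also have "\<dots> < c1 * (2 / exp 1) ^ k * ?K powr (1/4) * (2 * exp 1)"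
    using pos by (intro mult_strict_left_mono) auto
  finally show ?thesis by (simp only: mult_ac)
qed

lemma tau_upper_codegree:
  assumes "2 \<le> m" "m + 1 \<le> n"
  shows "tau n (n - m) \<le> exp 2 * real m powr (1/4) * (real m * exp 1 / 2) powr (real m / 2)
                          * real n powr (- real m / 2)"
proof -
  let ?N = "real n" and ?M = "real m"
  have m: "0 < ?M" "?M < ?N" using assms by auto
  have "tau n (n - m) \<le> exp (log_bound ?N (?N - ?M) / 2)"
    using tau_le[of "n - m" n] assms by (simp add: of_nat_diff)
  also have "\<dots> \<le> exp (2 + 1/4 * ln ?M + ?M / 2 * (ln ?M + 1 - ln 2) + - ?M / 2 * ln ?N)"
    using log_bound_diff_le[OF m] ln_2_ge_half by (simp add: algebra_simps add_divide_distrib diff_divide_distrib)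
  also have "\<dots> = exp 2 * ?M powr (1/4) * (?M * exp 1 / 2) powr (?M / 2) * ?N powr (- ?M / 2)"
  proof -
    have "ln (?M * exp 1 / 2) = ln ?M + 1 - ln 2"
      using m by (simp add: ln_div ln_mult_pos)
    then show ?thesis
      using m unfolding exp_add powr_def by simp
  qed
  finally show ?thesis .
qed

text \<open>A floor \<open>k\<close> of at least 1 satisfies
  \<open>lam * n < k + 1 \<le> 2 * k\<close>, so \<open>k / n\<close> stays in
  \<open>[lam/2, lam]\<close>, where \<open>rate\<close> is uniformly negative.\<close>

lemma tau_upper_linear:
  assumes "0 < lam" "lam < 1"
  shows "\<exists>\<rho>::real. 0 < \<rho> \<and> \<rho> < 1 \<and>
      (\<forall>n :: nat. nat \<lfloor>lam * real n\<rfloor> \<ge> 1 \<longrightarrow> n \<ge> nat \<lfloor>lam * real n\<rfloor> + 2 \<longrightarrow>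
         tau n (nat \<lfloor>lam * real n\<rfloor>) \<le> exp 2 * real n powr (1/4) * \<rho> powr (real n / 2))"
proof -
  obtain c where c: "c < 0" "\<And>t. lam / 2 \<le> t \<Longrightarrow> t \<le> lam \<Longrightarrow> rate t \<le> c"
    using rate_uniform[of "lam / 2" lam] assms by auto
  show ?thesis
  proof (intro exI[of _ "exp c"] conjI allI impI)
    fix n :: nat
    let ?N = "real n"
    define k where "k = nat \<lfloor>lam * ?N\<rfloor>"
    assume "nat \<lfloor>lam * ?N\<rfloor> \<ge> 1" "n \<ge> nat \<lfloor>lam * ?N\<rfloor> + 2"
    then have k1: "1 \<le> k" "k + 2 \<le> n" by (simp_all add: k_def)
    then have k: "0 < real k" "real k < ?N" by auto
    have "real k = of_int \<lfloor>lam * ?N\<rfloor>"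
      using k1 unfolding k_def by linarith
    then have "real k \<le> lam * ?N" "lam * ?N < real k + 1"
      by linarith+
    moreover have "real k + 1 \<le> 2 * real k" using k1 by simp
    ultimately have "lam / 2 \<le> real k / ?N" "real k / ?N \<le> lam"
      using k by (simp_all add: field_simps)
    then have "?N * rate (real k / ?N) \<le> ?N * c"
      using c(2) by (intro mult_left_mono) auto
    then have "log_bound ?N (real k) / 2 \<le> 2 + 1/4 * ln ?N + ?N / 2 * c"
      using log_bound_rate[OF k] ln_2_ge_half by linarith
    then have "exp (log_bound ?N (real k) / 2) \<le> exp (2 + 1/4 * ln ?N + ?N / 2 * c)"
      by simp
    also have "\<dots> = exp 2 * ?N powr (1/4) * exp c powr (?N / 2)"
      using k unfolding exp_add powr_def by simp
    finally show "tau n (nat \<lfloor>lam * ?N\<rfloor>) \<le> exp 2 * ?N powr (1/4) * exp c powr (?N / 2)"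
      using tau_le[OF k1] unfolding k_def by linarith
  qed (use c in auto)
qed

lemma tau_upper_half:
  assumes "even n" "4 \<le> n"
  shows "tau n (n div 2) < c1 * real n powr (1/4) * (4 / sqrt 27) ^ (n div 2)"
proof -
  define k where "k = n div 2"
  let ?K = "real k"
  have n: "n = 2 * k" "2 \<le> k" using assms by (auto simp: k_def)
  then have k: "0 < ?K" by simp
  have ln3: "ln 3 < 2 * ln (2::real)"
    using ln_less_ln_4[of 3] by simp
  have l27: "ln (4 / sqrt 27) = 2 * ln 2 - 3/2 * ln 3"
    using ln_realpow[of 2 2] ln_realpow[of 3 3] by (simp add: ln_div ln_sqrt)
  have "tau n k \<le> exp (log_bound (2 * ?K) ?K / 2)"
    using tau_le[of k n] n by simp
  also have "log_bound (2 * ?K) ?K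
      < 2 - ln 2 - ln pi / 2 + 1/2 * (ln 2 + ln ?K) + ?K * (4 * ln 2 - 3 * ln 3)"
  proof -
    \<comment> \<open>As \<open>ln 3\<close> and \<open>ln pi\<close> are below
      \<open>2 * ln 2\<close>, it suffices that \<open>1/4 \<le> ln 2\<close>.\<close>
    have "9/4 - 7/2 * ln 2 + ln 3 / 2 + ln ?K / 2
        < 2 - ln 2 - ln pi / 2 + 1/2 * (ln 2 + ln ?K)"
      using ln_2_ge_half ln_less_ln_4[OF pi_gt_zero pi_less_4] ln3 by argo
    then show ?thesis
      unfolding log_bound_double[OF k] by (rule add_strict_right_mono)
  qed
  then have "log_bound (2 * ?K) ?K / 2
      < (1 - ln 2 / 2 - ln pi / 4) + 1/4 * (ln 2 + ln ?K) + ?K * (2 * ln 2 - 3/2 * ln 3)"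
    by (simp add: algebra_simps)
  then have "exp (log_bound (2 * ?K) ?K / 2)
      < exp ((1 - ln 2 / 2 - ln pi / 4) + 1/4 * (ln 2 + ln ?K) + ?K * (2 * ln 2 - 3/2 * ln 3))"
    by simp
  also have "\<dots> = c1 * real n powr (1/4) * (4 / sqrt 27) ^ k"
  proof -
    have "ln (real n) = ln 2 + ln ?K"
      using n k by (simp add: ln_mult_pos)
    moreover have "exp (2 * ln 2 - 3/2 * ln 3) = 4 / sqrt 27"
      unfolding l27[symmetric] by simp
    ultimately show ?thesis
      using n unfolding exp_add c1_eq exp_of_nat_mult powr_def by simp
  qed
  finally show ?thesis by (simp add: k_def)
qed

theorem theorem1p5:
  shows "\<exists>c2 c3 c4 :: real. c2 > 0 \<and> c3 > 0 \<and> c4 > 0 \<and>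
    (\<forall>n k :: nat. k \<ge> 1 \<longrightarrow> n \<ge> k + 2 \<longrightarrow>
        tau n k \<le> c1 * (2 / exp 1) ^ k * real k powr (1/4)
                    / (1 - real k ^ 2 / real n ^ 2) powr (real k / 2)) \<and>
    (\<forall>n k :: nat. k \<ge> 1 \<longrightarrow> n \<ge> k + 2 \<longrightarrow> real n \<ge> real k powr (3/2) \<longrightarrow>
        tau n k < c2 * (2 / exp 1) ^ k * real k powr (1/4)) \<and>
    (\<forall>m n :: nat. m \<ge> 2 \<longrightarrow> n \<ge> m + 1 \<longrightarrow>
        tau n (n - m) \<le> c3 * real m powr (1/4) * (real m * exp 1 / 2) powr (real m / 2)
                          * real n powr (- real m / 2)) \<and>
    (\<forall>lam::real. 0 < lam \<and> lam < 1 \<longrightarrow>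
        (\<exists>\<rho>::real. 0 < \<rho> \<and> \<rho> < 1 \<and>
          (\<forall>n :: nat. nat \<lfloor>lam * real n\<rfloor> \<ge> 1 \<longrightarrow> n \<ge> nat \<lfloor>lam * real n\<rfloor> + 2 \<longrightarrow>
             tau n (nat \<lfloor>lam * real n\<rfloor>) \<le> c4 * real n powr (1/4) * \<rho> powr (real n / 2)))) \<and>
    (\<forall>n :: nat. even n \<longrightarrow> n \<ge> 4 \<longrightarrow>
        tau n (n div 2) < c1 * real n powr (1/4) * (4 / sqrt 27) ^ (n div 2))"
proof (rule exI[of _ "2 * c1 * exp 1"], rule exI[of _ "exp 2"], rule exI[of _ "exp 2"],
    intro conjI)
  show "2 * c1 * exp 1 > 0" by (simp add: c1_eq)
  show "exp (2::real) > 0" "exp (2::real) > 0" by (fact exp_gt_zero)+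
  show "\<forall>n k :: nat. k \<ge> 1 \<longrightarrow> n \<ge> k + 2 \<longrightarrow>
        tau n k \<le> c1 * (2 / exp 1) ^ k * real k powr (1/4)
                    / (1 - real k ^ 2 / real n ^ 2) powr (real k / 2)"
    by (intro allI impI) (fact tau_upper)
  show "\<forall>n k :: nat. k \<ge> 1 \<longrightarrow> n \<ge> k + 2 \<longrightarrow> real n \<ge> real k powr (3/2) \<longrightarrow>
        tau n k < 2 * c1 * exp 1 * (2 / exp 1) ^ k * real k powr (1/4)"
    by (intro allI impI) (fact tau_upper_large)
  show "\<forall>m n :: nat. m \<ge> 2 \<longrightarrow> n \<ge> m + 1 \<longrightarrow>
        tau n (n - m) \<le> exp 2 * real m powr (1/4) * (real m * exp 1 / 2) powr (real m / 2)
                          * real n powr (- real m / 2)"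
    by (intro allI impI) (fact tau_upper_codegree)
  show "\<forall>lam::real. 0 < lam \<and> lam < 1 \<longrightarrow>
        (\<exists>\<rho>::real. 0 < \<rho> \<and> \<rho> < 1 \<and>
          (\<forall>n :: nat. nat \<lfloor>lam * real n\<rfloor> \<ge> 1 \<longrightarrow> n \<ge> nat \<lfloor>lam * real n\<rfloor> + 2 \<longrightarrow>
             tau n (nat \<lfloor>lam * real n\<rfloor>) \<le> exp 2 * real n powr (1/4) * \<rho> powr (real n / 2)))"
    by (intro allI impI, elim conjE) (rule tau_upper_linear)
  show "\<forall>n :: nat. even n \<longrightarrow> n \<ge> 4 \<longrightarrow>
        tau n (n div 2) < c1 * real n powr (1/4) * (4 / sqrt 27) ^ (n div 2)"
    by (intro allI impI) (fact tau_upper_half)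
qed

end
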